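(* Let $\mathsf{Pin}^+(3)$, $\mathsf{Pin}'^{+}(3)$, $\mathsf{PIN}^+(3)$ and $\mathsf{Spin}^+(3)$ be the Pin groups and the Spin group of Euclidean $3$-space as defined in the context, viewed as subgroups of $\mathrm{GL}(2,\mathbb C)$. One has (1) $\mathrm{SU}(2)=\mathsf{Spin}^{+}(3)=\mathsf{Pin}^{+}(3)$, (2) $\mathrm U(2)^{\pm1}=\mathsf{PIN}^{+}(3)=\mathsf{Pin}'^{+}(3)$.
   Context: $\mathrm U(2)^{\pm1}=\{A\in\mathrm{GL}(2,\mathbb C)\mid A\overline A^{T}=\mathbf 1,\ \det A=\pm1\}$. The Clifford algebra of Euclidean $3$-space (positive definite form $x_1^2+x_2^2+x_3^2$) is realized as the real algebra $\mathit{Cl}=\mathrm{Mat}_{2\times2}(\mathbb C)$, with Euclidean $3$-space spanned by the Pauli matrices $$e_1=\begin{pmatrix}0&1\\1&0\end{pmatrix},\quad e_2=\begin{pmatrix}0&-i\\i&0\end{pmatrix},\quad e_3=\begin{pmatrix}1&0\\0&-1\end{pmatrix},$$ which satisfy $e_\nu^2=\mathbf 1$ and $e_\mu e_\nu=-e_\nu e_\mu$ for $\mu\ne\nu$. As a real vector space $\mathit{Cl}=\mathit{Cl}^0\oplus\mathit{Cl}^1\oplus\mathit{Cl}^2\oplus\mathit{Cl}^3$ with $\mathit{Cl}^0=\mathbb R\mathbf 1$, $\mathit{Cl}^1=\mathbb Re_1\oplus\mathbb Re_2\oplus\mathbb Re_3$, $\mathit{Cl}^2=\mathbb Re_1e_2\oplus\mathbb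 Re_1e_3\oplus\mathbb Re_2e_3$, $\mathit{Cl}^3=\mathbb Re_1e_2e_3$. The even part is $\mathit{Cl}^{\underline0}=\mathit{Cl}^0\oplus\mathit{Cl}^2$, the odd part is $\mathit{Cl}^{\underline1}=\mathit{Cl}^1\oplus\mathit{Cl}^3$; $\mathit{Cl}^*_{hom}$ is the group of invertible elements lying in $\mathit{Cl}^{\underline0}\cup\mathit{Cl}^{\underline1}$. The $\mathbb R$-linear maps $t$ and $x\mapsto\overline x$ on $\mathit{Cl}$ act on $(\mathit{Cl}^0,\mathit{Cl}^1,\mathit{Cl}^2,\mathit{Cl}^3)$ by the signs $(+,+,-,-)$ and $(+,-,-,+)$ respectively. Put $N(x)=\overline x\,x$ and $N'(x)=t(x)\,x$; restricted to $\mathit{Cl}^*_{hom}$ these are group homomorphisms to $\mathbb R^*\mathbf 1\cong\mathbb R^*$, and $N^2=(N')^2$ there. Define $$\mathsf{Pin}^+(3)=\ker(N|_{\mathit{Cl}^*_{hom}}),\quad\mathsf{Pin}'^{+}(3)=\ker(N'|_{\mathit{Cl}^*_{hom}}),\quad\mathsf{PIN}^+(3)=\ker(N^2|_{\mathit{Cl}^*_{hom}}),$$ and $\mathsf{Spin}^+(3)$ is the intersection of any of these with $\mathit{Cl}^{\underline0}$ (the three intersections coincide). *)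

theory Defs
  imports "HOL-Analysis.Analysis" "HOL-Algebra.Coset"
begin

text \<open>
  The type \<^typ>\<open>complex ^ 2 ^ 2\<close> carries the real algebra of complex 2 x 2 matrices. Its product is
  \<^term>\<open>(**)\<close> (the type class operations \<open>*\<close> and \<open>^\<close> are componentwise), its unit is \<^term>\<open>mat 1\<close>,
  and \<^const>\<open>span\<close> and \<^const>\<open>linear\<close> refer to the real vector space structure.
\<close>

type_synonym cl = "complex ^ 2 ^ 2"

definition e1 :: cl where "e1 = vector [vector [0, 1], vector [1, 0]]"
definition e2 :: cl where "e2 = vector [vector [0, - \<i>], vector [\<i>, 0]]"
definition e3 :: cl where "e3 = vector [vector [1, 0], vector [0, - 1]]"

definition Cl0 :: "cl set" where "Cl0 = span {mat 1}"
definition Cl1 :: "cl set" where "Cl1 = span {e1, e2, e3}"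
definition Cl2 :: "cl set" where "Cl2 = span {e1 ** e2, e1 ** e3, e2 ** e3}"
definition Cl3 :: "cl set" where "Cl3 = span {e1 ** e2 ** e3}"

definition Cl_even :: "cl set" where "Cl_even = {x + y | x y. x \<in> Cl0 \<and> y \<in> Cl2}"
definition Cl_odd :: "cl set" where "Cl_odd = {x + y | x y. x \<in> Cl1 \<and> y \<in> Cl3}"

text \<open>
  The real linear map acting as a given scalar on each of the four summands; it exists and is
  unique by \<open>ex1_graded_map\<close> below, so the description is proper.
\<close>

definition graded_map :: "real \<Rightarrow> real \<Rightarrow> real \<Rightarrow> real \<Rightarrow> cl \<Rightarrow> cl" where
  "graded_map s0 s1 s2 s3 = (THE f. linear f \<and>
     (\<forall>x\<in>Cl0. f x = s0 *\<^sub>R x) \<and> (\<forall>x\<in>Cl1. f x = s1 *\<^sub>R x) \<and>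
     (\<forall>x\<in>Cl2. f x = s2 *\<^sub>R x) \<and> (\<forall>x\<in>Cl3. f x = s3 *\<^sub>R x))"

definition cl_t :: "cl \<Rightarrow> cl" where "cl_t = graded_map 1 1 (- 1) (- 1)"
definition cl_bar :: "cl \<Rightarrow> cl" where "cl_bar = graded_map 1 (- 1) (- 1) 1"

definition cl_N :: "cl \<Rightarrow> cl" where "cl_N x = cl_bar x ** x"
definition cl_N' :: "cl \<Rightarrow> cl" where "cl_N' x = cl_t x ** x"

definition GL2 :: "cl monoid" where
  "GL2 = \<lparr>carrier = {A. invertible A}, monoid.mult = (**), one = mat 1\<rparr>"

definition Cl_hom :: "cl monoid" where
  "Cl_hom = GL2\<lparr>carrier := {x \<in> Cl_even \<union> Cl_odd. invertible x}\<rparr>"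

text \<open>The group of nonzero real multiples of the identity matrix, the common target of the norms.\<close>

definition real_scalars :: "cl monoid" where
  "real_scalars = GL2\<lparr>carrier := {c *\<^sub>R mat 1 | c :: real. c \<noteq> 0}\<rparr>"

definition Pin3 :: "cl set" where "Pin3 = kernel Cl_hom real_scalars cl_N"
definition Pin3' :: "cl set" where "Pin3' = kernel Cl_hom real_scalars cl_N'"
definition PIN3 :: "cl set" where "PIN3 = kernel Cl_hom real_scalars (\<lambda>x. cl_N x ** cl_N x)"
definition Spin3 :: "cl set" where "Spin3 = Pin3 \<inter> Cl_even"

definition conj_transpose :: "cl \<Rightarrow> cl" where
  "conj_transpose A = transpose (\<chi> i j. cnj (A $ i $ j))"

definition U2pm :: "cl set" where
  "U2pm = {A \<in> carrier GL2. A ** conj_transpose A = mat 1 \<and> (det A = 1 \<or> det A = - 1)}"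

definition SU2 :: "cl set" where
  "SU2 = {A \<in> carrier GL2. A ** conj_transpose A = mat 1 \<and> det A = 1}"


lemmas cl_simps = vec_eq_iff forall_2 matrix_matrix_mult_def sum_2 mat_def complex_eq_iff
  e1_def e2_def e3_def

lemma clifford_relations:
  "e1 ** e1 = mat 1" "e2 ** e2 = mat 1" "e3 ** e3 = mat 1"
  "e1 ** e2 = - (e2 ** e1)" "e1 ** e3 = - (e3 ** e1)" "e2 ** e3 = - (e3 ** e2)"
  by (simp_all add: cl_simps)

lemma e12_eq: "e1 ** e2 = vector [vector [\<i>, 0], vector [0, - \<i>]]"
  and e13_eq: "e1 ** e3 = vector [vector [0, - 1], vector [1, 0]]"
  and e23_eq: "e2 ** e3 = vector [vector [0, \<i>], vector [\<i>, 0]]"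
  and e123_eq: "e1 ** e2 ** e3 = vector [vector [\<i>, 0], vector [0, \<i>]]"
  by (simp_all add: cl_simps)

lemma mat1_eq: "(mat 1 :: cl) = vector [vector [1, 0], vector [0, 1]]"
  by (simp add: cl_simps)

lemmas blade_eqs = mat1_eq e1_def e2_def e3_def e12_eq e13_eq e23_eq e123_eq

lemma Cl0_eq: "Cl0 = range (\<lambda>a. a *\<^sub>R mat 1)"
  by (simp add: Cl0_def span_singleton)

lemma Cl3_eq: "Cl3 = range (\<lambda>a. a *\<^sub>R (e1 ** e2 ** e3))"
  by (simp add: Cl3_def span_singleton)

lemma span_3: "span {u, v, w :: 'a :: real_vector} = {a *\<^sub>R u + b *\<^sub>R v + c *\<^sub>R w | a b c. True}"
proof -
  have "x \<in> span {u, v, w} \<longleftrightarrow> (\<exists>a b c. x = a *\<^sub>R u + b *\<^sub>R v + c *\<^sub>R w)" for x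
    unfolding span_breakdown_eq span_empty by (simp add: algebra_simps) 
  then show ?thesis by auto
qed

lemma Cl1_eq: "Cl1 = {a *\<^sub>R e1 + b *\<^sub>R e2 + c *\<^sub>R e3 | a b c. True}"
  by (simp add: Cl1_def span_3)

lemma Cl2_eq: "Cl2 = {a *\<^sub>R (e1 ** e2) + b *\<^sub>R (e1 ** e3) + c *\<^sub>R (e2 ** e3) | a b c. True}"
  by (simp add: Cl2_def span_3)

lemma cl_decompose:
  "\<exists>x0\<in>Cl0. \<exists>x1\<in>Cl1. \<exists>x2\<in>Cl2. \<exists>x3\<in>Cl3. x = x0 + x1 + x2 + x3"
proof -
  let ?a = "x $ 1 $ 1" and ?b = "x $ 1 $ 2" and ?c = "x $ 2 $ 1" and ?d = "x $ 2 $ 2"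
  have "x = (Re (?a + ?d) / 2) *\<^sub>R mat 1
      + ((Re (?b + ?c) / 2) *\<^sub>R e1 + (Im (?c - ?b) / 2) *\<^sub>R e2 + (Re (?a - ?d) / 2) *\<^sub>R e3)
      + ((Im (?a - ?d) / 2) *\<^sub>R (e1 ** e2) + (Re (?c - ?b) / 2) *\<^sub>R (e1 ** e3)
         + (Im (?b + ?c) / 2) *\<^sub>R (e2 ** e3))
      + (Im (?a + ?d) / 2) *\<^sub>R (e1 ** e2 ** e3)"
    unfolding e12_eq e13_eq e23_eq e123_eq
    by (simp add: cl_simps add_divide_distrib diff_divide_distrib)
  then show ?thesis
    unfolding Cl0_eq Cl1_eq Cl2_eq Cl3_eq by blast
qed

lemma ex1_graded_map:
  "\<exists>!f :: cl \<Rightarrow> cl. linear f \<and>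
     (\<forall>x\<in>Cl0. f x = s0 *\<^sub>R x) \<and> (\<forall>x\<in>Cl1. f x = s1 *\<^sub>R x) \<and>
     (\<forall>x\<in>Cl2. f x = s2 *\<^sub>R x) \<and> (\<forall>x\<in>Cl3. f x = s3 *\<^sub>R x)"
proof (rule ex_ex1I)
  define f :: "cl \<Rightarrow> cl" where "f x =
       (s0 * Re (x $ 1 $ 1 + x $ 2 $ 2) / 2) *\<^sub>R mat 1
      + ((s1 * Re (x $ 1 $ 2 + x $ 2 $ 1) / 2) *\<^sub>R e1 + (s1 * Im (x $ 2 $ 1 - x $ 1 $ 2) / 2) *\<^sub>R e2
         + (s1 * Re (x $ 1 $ 1 - x $ 2 $ 2) / 2) *\<^sub>R e3)
      + ((s2 * Im (x $ 1 $ 1 - x $ 2 $ 2) / 2) *\<^sub>R (e1 ** e2)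
         + (s2 * Re (x $ 2 $ 1 - x $ 1 $ 2) / 2) *\<^sub>R (e1 ** e3)
         + (s2 * Im (x $ 1 $ 2 + x $ 2 $ 1) / 2) *\<^sub>R (e2 ** e3))
      + (s3 * Im (x $ 1 $ 1 + x $ 2 $ 2) / 2) *\<^sub>R (e1 ** e2 ** e3)" for x
  have "linear f"
    by (rule linearI) (simp_all add: f_def algebra_simps add_divide_distrib diff_divide_distrib)
  moreover have "(\<forall>x\<in>Cl0. f x = s0 *\<^sub>R x) \<and> (\<forall>x\<in>Cl1. f x = s1 *\<^sub>R x) \<and>
     (\<forall>x\<in>Cl2. f x = s2 *\<^sub>R x) \<and> (\<forall>x\<in>Cl3. f x = s3 *\<^sub>R x)"
    unfolding f_def Cl0_eq Cl1_eq Cl2_eq Cl3_eq e12_eq e13_eq e23_eq e123_eq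
    by (auto simp: cl_simps)
  ultimately show "\<exists>f. linear f \<and>
     (\<forall>x\<in>Cl0. f x = s0 *\<^sub>R x) \<and> (\<forall>x\<in>Cl1. f x = s1 *\<^sub>R x) \<and>
     (\<forall>x\<in>Cl2. f x = s2 *\<^sub>R x) \<and> (\<forall>x\<in>Cl3. f x = s3 *\<^sub>R x)" by blast
next
  fix f g :: "cl \<Rightarrow> cl"
  assume f: "linear f \<and>
     (\<forall>x\<in>Cl0. f x = s0 *\<^sub>R x) \<and> (\<forall>x\<in>Cl1. f x = s1 *\<^sub>R x) \<and>
     (\<forall>x\<in>Cl2. f x = s2 *\<^sub>R x) \<and> (\<forall>x\<in>Cl3. f x = s3 *\<^sub>R x)"
   and g: "linear g \<and>
     (\<forall>x\<in>Cl0. g x = s0 *\<^sub>R x) \<and> (\<forall>x\<in>Cl1. g x = s1 *\<^sub>R x) \<and>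
     (\<forall>x\<in>Cl2. g x = s2 *\<^sub>R x) \<and> (\<forall>x\<in>Cl3. g x = s3 *\<^sub>R x)"
  show "f = g"
  proof
    fix x
    obtain x0 x1 x2 x3 where "x0 \<in> Cl0" "x1 \<in> Cl1" "x2 \<in> Cl2" "x3 \<in> Cl3" "x = x0 + x1 + x2 + x3"
      using cl_decompose by blast
    then show "f x = g x" using f g by (simp add: linear_add)
  qed
qed

lemma graded_map_props:
  "linear (graded_map s0 s1 s2 s3)"
  "x \<in> Cl0 \<Longrightarrow> graded_map s0 s1 s2 s3 x = s0 *\<^sub>R x"
  "x \<in> Cl1 \<Longrightarrow> graded_map s0 s1 s2 s3 x = s1 *\<^sub>R x"
  "x \<in> Cl2 \<Longrightarrow> graded_map s0 s1 s2 s3 x = s2 *\<^sub>R x"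
  "x \<in> Cl3 \<Longrightarrow> graded_map s0 s1 s2 s3 x = s3 *\<^sub>R x"
  using theI'[OF ex1_graded_map[of s0 s1 s2 s3], folded graded_map_def] by blast+

lemma group_GL2: "group GL2"
proof (rule groupI)
  fix A assume "A \<in> carrier GL2"
  then obtain B where "A ** B = mat 1" "B ** A = mat 1"
    by (auto simp: GL2_def invertible_def)
  then show "\<exists>B\<in>carrier GL2. B \<otimes>\<^bsub>GL2\<^esub> A = \<one>\<^bsub>GL2\<^esub>"
    by (auto simp: GL2_def invertible_def)
next
  fix A B assume "A \<in> carrier GL2" "B \<in> carrier GL2"
  then show "A \<otimes>\<^bsub>GL2\<^esub> B \<in> carrier GL2" by (simp add: GL2_def invertible_mult)
next
  show "\<one>\<^bsub>GL2\<^esub> \<in> carrier GL2" by (auto simp: GL2_def invertible_def)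
qed (simp_all add: GL2_def matrix_mul_assoc)

lemma Cl_even_iff: "x \<in> Cl_even \<longleftrightarrow> x $ 2 $ 2 = cnj (x $ 1 $ 1) \<and> x $ 2 $ 1 = - cnj (x $ 1 $ 2)"
proof
  assume "x \<in> Cl_even"
  then show "x $ 2 $ 2 = cnj (x $ 1 $ 1) \<and> x $ 2 $ 1 = - cnj (x $ 1 $ 2)"
    unfolding Cl_even_def Cl0_eq Cl2_eq e12_eq e13_eq e23_eq by (auto simp: cl_simps)
next
  assume *: "x $ 2 $ 2 = cnj (x $ 1 $ 1) \<and> x $ 2 $ 1 = - cnj (x $ 1 $ 2)"
  have "x = (Re (x $ 1 $ 1)) *\<^sub>R mat 1 + ((Im (x $ 1 $ 1)) *\<^sub>R (e1 ** e2)
      + (- Re (x $ 1 $ 2)) *\<^sub>R (e1 ** e3) + (Im (x $ 1 $ 2)) *\<^sub>R (e2 ** e3))"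
    unfolding e12_eq e13_eq e23_eq using * by (simp add: cl_simps)
  then show "x \<in> Cl_even"
    unfolding Cl_even_def Cl0_eq Cl2_eq by blast
qed

lemma Cl_odd_iff: "x \<in> Cl_odd \<longleftrightarrow> x $ 2 $ 2 = - cnj (x $ 1 $ 1) \<and> x $ 2 $ 1 = cnj (x $ 1 $ 2)"
proof
  assume "x \<in> Cl_odd"
  then show "x $ 2 $ 2 = - cnj (x $ 1 $ 1) \<and> x $ 2 $ 1 = cnj (x $ 1 $ 2)"
    unfolding Cl_odd_def Cl1_eq Cl3_eq e123_eq by (auto simp: cl_simps)
next
  assume *: "x $ 2 $ 2 = - cnj (x $ 1 $ 1) \<and> x $ 2 $ 1 = cnj (x $ 1 $ 2)"
  have "x = (Re (x $ 1 $ 2) *\<^sub>R e1 + (- Im (x $ 1 $ 2)) *\<^sub>R e2 + Re (x $ 1 $ 1) *\<^sub>R e3)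
      + Im (x $ 1 $ 1) *\<^sub>R (e1 ** e2 ** e3)"
    unfolding e123_eq using * by (simp add: cl_simps)
  then show "x \<in> Cl_odd"
    unfolding Cl_odd_def Cl1_eq Cl3_eq by blast
qed

lemma graded_map_eqI:
  assumes "linear f"
    and "\<And>x. x \<in> Cl0 \<Longrightarrow> f x = s0 *\<^sub>R x" "\<And>x. x \<in> Cl1 \<Longrightarrow> f x = s1 *\<^sub>R x"
    and "\<And>x. x \<in> Cl2 \<Longrightarrow> f x = s2 *\<^sub>R x" "\<And>x. x \<in> Cl3 \<Longrightarrow> f x = s3 *\<^sub>R x"
  shows "graded_map s0 s1 s2 s3 = f"
  unfolding graded_map_def by (rule the1_equality[OF ex1_graded_map]) (use assms in blast)

lemma cl_t_eq: "cl_t = conj_transpose"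
  unfolding cl_t_def
proof (rule graded_map_eqI)
  show "linear conj_transpose"
    by (rule linearI) (simp_all add: conj_transpose_def transpose_def cl_simps)
qed (auto simp: conj_transpose_def transpose_def Cl0_eq Cl1_eq Cl2_eq Cl3_eq
    e12_eq e13_eq e23_eq e123_eq cl_simps)

lemma cl_bar_eq:
  "cl_bar = (\<lambda>x. vector [vector [x $ 2 $ 2, - (x $ 1 $ 2)], vector [- (x $ 2 $ 1), x $ 1 $ 1]])"
  unfolding cl_bar_def
  by (rule graded_map_eqI, rule linearI)
    (auto simp: Cl0_eq Cl1_eq Cl2_eq Cl3_eq e12_eq e13_eq e23_eq e123_eq cl_simps)

definition qnorm :: "cl \<Rightarrow> real" where
  "qnorm x = (Re (x $ 1 $ 1))\<^sup>2 + (Im (x $ 1 $ 1))\<^sup>2 + (Re (x $ 1 $ 2))\<^sup>2 + (Im (x $ 1 $ 2))\<^sup>2"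

lemma qnorm_nonneg: "qnorm x \<ge> 0"
  by (simp add: qnorm_def)

lemma qnorm_eq_0: "qnorm x = 0 \<longleftrightarrow> x $ 1 $ 1 = 0 \<and> x $ 1 $ 2 = 0"
  by (auto simp: qnorm_def complex_eq_iff add_nonneg_eq_0_iff)

lemma cl_N_even: "x \<in> Cl_even \<Longrightarrow> cl_N x = qnorm x *\<^sub>R mat 1"
  and cl_N_odd: "x \<in> Cl_odd \<Longrightarrow> cl_N x = (- qnorm x) *\<^sub>R mat 1"
  and cl_N'_even: "x \<in> Cl_even \<Longrightarrow> cl_N' x = qnorm x *\<^sub>R mat 1"
  and cl_N'_odd: "x \<in> Cl_odd \<Longrightarrow> cl_N' x = qnorm x *\<^sub>R mat 1"
  unfolding Cl_even_iff Cl_odd_iff cl_N_def cl_N'_def cl_bar_eq cl_t_eq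
  by (auto simp: conj_transpose_def transpose_def cl_simps qnorm_def power2_eq_square algebra_simps)

lemma cl_N'_sq: "x \<in> Cl_even \<union> Cl_odd \<Longrightarrow> cl_N x ** cl_N x = cl_N' x ** cl_N' x"
  by (auto simp: cl_N_even cl_N_odd cl_N'_even cl_N'_odd cl_simps)

lemma cl_N_mult: "cl_N (x ** y) = cl_N x ** cl_N y"
  by (simp add: cl_N_def cl_bar_eq cl_simps algebra_simps)

lemma cl_N_real:
  assumes "x \<in> carrier Cl_hom" shows "cl_N x \<in> carrier real_scalars"
    and "cl_N' x \<in> carrier real_scalars"
proof -
  let ?r = "qnorm x"
  have x: "x \<in> Cl_even \<or> x \<in> Cl_odd" and "invertible x" using assms by (auto simp: Cl_hom_def)
  have "?r \<noteq> 0"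
  proof
    assume "?r = 0"
    then have "x = 0"
      using x by (auto simp: qnorm_eq_0 Cl_even_iff Cl_odd_iff vec_eq_iff forall_2)
    with \<open>invertible x\<close> show False
      by (auto simp: invertible_def vec_eq_iff forall_2 matrix_matrix_mult_def mat_def)
  qed
  then have "- ?r \<noteq> 0" by linarith
  show "cl_N x \<in> carrier real_scalars"
    using x cl_N_even cl_N_odd \<open>?r \<noteq> 0\<close> \<open>- ?r \<noteq> 0\<close> unfolding real_scalars_def
    by (auto simp del: scaleR_minus_left)
  show "cl_N' x \<in> carrier real_scalars"
    using x cl_N'_even cl_N'_odd \<open>?r \<noteq> 0\<close> unfolding real_scalars_def by auto
qed

lemma cl_N_hom: "cl_N \<in> hom Cl_hom real_scalars"
  using cl_N_real(1) by (auto simp: hom_def Cl_hom_def real_scalars_def GL2_def cl_N_mult)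

lemma cl_N'_hom: "cl_N' \<in> hom Cl_hom real_scalars"
proof (rule homI)
  fix x y assume "x \<in> carrier Cl_hom" "y \<in> carrier Cl_hom"
  then obtain c where c: "cl_N' x = c *\<^sub>R mat 1"
    using cl_N_real(2) by (auto simp: real_scalars_def)
  have "cl_N' (x ** y) = cl_t y ** (cl_t x ** x) ** y"
    unfolding cl_N'_def cl_t_eq
    by (simp add: conj_transpose_def transpose_def cl_simps algebra_simps)
  also have "\<dots> = cl_t y ** (c *\<^sub>R mat 1) ** y"
    using c by (simp add: cl_N'_def)
  also have "\<dots> = cl_N' x ** cl_N' y"
    unfolding c by (simp add: cl_N'_def cl_simps algebra_simps)
  finally show "cl_N' (x \<otimes>\<^bsub>Cl_hom\<^esub> y) = cl_N' x \<otimes>\<^bsub>real_scalars\<^esub> cl_N' y"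
    by (simp add: Cl_hom_def real_scalars_def GL2_def)
qed (rule cl_N_real(2))

lemma scaleR_mult_left: "(r *\<^sub>R x) ** (y :: cl) = r *\<^sub>R (x ** y)"
  and scaleR_mult_right: "(x :: cl) ** (r *\<^sub>R y) = r *\<^sub>R (x ** y)"
  by (simp_all add: cl_simps algebra_simps)

lemma subgroup_Cl_hom: "subgroup (carrier Cl_hom) GL2"
proof (rule group.subgroupI[OF group_GL2])
  show "carrier Cl_hom \<subseteq> carrier GL2" by (auto simp: Cl_hom_def GL2_def)
  have "mat 1 \<in> carrier Cl_hom"
    using group.is_monoid[OF group_GL2, THEN monoid.one_closed]
    by (simp add: Cl_hom_def GL2_def Cl_even_iff mat_def)
  then show "carrier Cl_hom \<noteq> {}" by blast
next
  fix a assume a: "a \<in> carrier Cl_hom"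
  then obtain c where c: "c \<noteq> 0" "cl_N a = c *\<^sub>R mat 1"
    using cl_N_real(1) by (auto simp: real_scalars_def)
  have aG: "a \<in> carrier GL2" using a by (simp add: Cl_hom_def GL2_def)
  let ?b = "(1 / c) *\<^sub>R cl_bar a"
  have "cl_bar a ** a = c *\<^sub>R mat 1" "a ** cl_bar a = c *\<^sub>R mat 1"
    using c(2) unfolding cl_N_def cl_bar_eq by (auto simp: cl_simps algebra_simps)
  then have ba: "?b ** a = mat 1" "a ** ?b = mat 1"
    using c(1) by (simp_all add: scaleR_mult_left scaleR_mult_right)
  have bG: "?b \<in> carrier GL2" using ba by (auto simp: GL2_def invertible_def)
  have "inv\<^bsub>GL2\<^esub> a = ?b"
    using group.inv_equality[OF group_GL2 _ aG bG] ba(1) by (simp add: GL2_def)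
  moreover have "?b \<in> Cl_even \<union> Cl_odd"
    using a by (auto simp: Cl_hom_def Cl_even_iff Cl_odd_iff cl_bar_eq complex_eq_iff)
  ultimately show "inv\<^bsub>GL2\<^esub> a \<in> carrier Cl_hom"
    using bG by (simp add: Cl_hom_def GL2_def)
next
  fix a b assume "a \<in> carrier Cl_hom" "b \<in> carrier Cl_hom"
  moreover have "(a ** b) $ i $ j = a $ i $ 1 * b $ 1 $ j + a $ i $ 2 * b $ 2 $ j" for i j
    by (simp add: matrix_matrix_mult_def sum_2)
  ultimately show "a \<otimes>\<^bsub>GL2\<^esub> b \<in> carrier Cl_hom"
    by (auto simp: Cl_hom_def GL2_def invertible_mult Cl_even_iff Cl_odd_iff)
qed

lemma subgroup_real_scalars: "subgroup (carrier real_scalars) GL2"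
proof (rule group.subgroupI[OF group_GL2])
  have unit: "((1 / c) *\<^sub>R mat 1) ** (c *\<^sub>R mat 1) = (mat 1 :: cl)"
             "(c *\<^sub>R mat 1) ** ((1 / c) *\<^sub>R mat 1) = (mat 1 :: cl)" if "c \<noteq> 0" for c :: real
    using that by (simp_all add: scaleR_mult_left scaleR_mult_right)
  show sub: "carrier real_scalars \<subseteq> carrier GL2"
    using unit by (auto simp: real_scalars_def GL2_def invertible_def)
  show "carrier real_scalars \<noteq> {}" by (auto simp: real_scalars_def intro!: exI[of _ 1])
  fix a assume a: "a \<in> carrier real_scalars"
  then obtain c where c: "c \<noteq> 0" "a = c *\<^sub>R mat 1" by (auto simp: real_scalars_def)
  have b: "(1 / c) *\<^sub>R mat 1 \<in> carrier real_scalars" 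
    using c(1) unfolding real_scalars_def by (auto intro!: exI[of _ "1 / c"])
  have "inv\<^bsub>GL2\<^esub> a = (1 / c) *\<^sub>R mat 1"
    by (rule group.inv_equality[OF group_GL2]) (use unit[OF c(1)] c(2) a b sub in \<open>auto simp: GL2_def\<close>)
  then show "inv\<^bsub>GL2\<^esub> a \<in> carrier real_scalars" using b by simp
  fix b assume "b \<in> carrier real_scalars"
  then obtain d where "d \<noteq> 0" "b = d *\<^sub>R mat 1" by (auto simp: real_scalars_def)
  then have "a \<otimes>\<^bsub>GL2\<^esub> b = (c * d) *\<^sub>R mat 1 \<and> c * d \<noteq> 0"
    using c by (simp add: GL2_def scaleR_mult_left scaleR_mult_right)
  then show "a \<otimes>\<^bsub>GL2\<^esub> b \<in> carrier real_scalars" unfolding real_scalars_def by auto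
qed

lemma subgroup_kernel_GL2:
  assumes "h \<in> hom Cl_hom real_scalars"
  shows "subgroup (kernel Cl_hom real_scalars h) GL2"
proof -
  have eq: "GL2\<lparr>carrier := carrier Cl_hom\<rparr> = Cl_hom" "GL2\<lparr>carrier := carrier real_scalars\<rparr> = real_scalars"
    by (simp_all add: Cl_hom_def real_scalars_def)
  have "group Cl_hom" "group real_scalars"
    using group.subgroup_imp_group[OF group_GL2 subgroup_Cl_hom]
      group.subgroup_imp_group[OF group_GL2 subgroup_real_scalars] by (simp_all add: eq)
  then have "group_hom Cl_hom real_scalars h"
    using assms by (simp add: group_hom_def group_hom_axioms_def)
  then have "subgroup (kernel Cl_hom real_scalars h) Cl_hom"
    by (rule group_hom.subgroup_kernel)
  then show ?thesis
    using group.incl_subgroup[OF group_GL2 subgroup_Cl_hom] by (simp add: eq)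
qed

lemma subgroup_Pin3: "subgroup Pin3 GL2" and subgroup_Pin3': "subgroup Pin3' GL2"
  unfolding Pin3_def Pin3'_def by (intro subgroup_kernel_GL2 cl_N_hom cl_N'_hom)+

lemma Spin3_alt: "Spin3 = Pin3' \<inter> Cl_even" "Spin3 = PIN3 \<inter> Cl_even"
proof -
  show "Spin3 = Pin3' \<inter> Cl_even"
    by (auto simp: Spin3_def Pin3_def Pin3'_def kernel_def cl_N_even cl_N'_even)
  have "(r *\<^sub>R mat 1 :: cl) ** (r *\<^sub>R mat 1) = mat 1 \<longleftrightarrow> (r *\<^sub>R mat 1 :: cl) = mat 1"
    if "r \<ge> 0" for r :: real
    using that by (auto simp: cl_simps power2_eq_1_iff[unfolded power2_eq_square])
  then show "Spin3 = PIN3 \<inter> Cl_even"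
    by (auto simp: Spin3_def Pin3_def PIN3_def kernel_def cl_N_even qnorm_nonneg real_scalars_def GL2_def)
qed

end

theory Submission imports Defs begin

text \<open>
  The map \<^const>\<open>cl_bar\<close> is the adjugate and \<^const>\<open>cl_t\<close> the conjugate transpose, so that
  \<open>N = det\<close> and \<open>N'(x) = x* x\<close>. A matrix is even or odd exactly when its conjugate transpose
  equals its adjugate or minus its adjugate. A unitary matrix with determinant \<open>1\<close> or \<open>-1\<close>
  is therefore even or odd respectively. Conversely, on homogeneous elements \<open>N'\<close> is a positive
  scalar, and the sign of \<open>N\<close> detects the parity.
\<close>

lemma matrix_right_inverse_unique:
  fixes A :: "'a :: field ^ 'n ^ 'n"
  assumes "A ** B = mat 1" "A ** C = mat 1"
  shows "B = C"
  by (metis assms matrix_left_right_inverse matrix_mul_assoc matrix_mul_lid matrix_mul_rid)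

lemma Cl_even_iff_conj_transpose: "x \<in> Cl_even \<longleftrightarrow> conj_transpose x = cl_bar x"
  and Cl_odd_iff_conj_transpose: "x \<in> Cl_odd \<longleftrightarrow> conj_transpose x = - cl_bar x"
  by (auto simp: Cl_even_iff Cl_odd_iff conj_transpose_def transpose_def cl_bar_eq cl_simps)

text \<open>The adjugate identity: \<open>x ** cl_bar x\<close> is \<open>det x\<close> times the
  unit.\<close>

lemma mult_cl_bar:
  "det x = 1 \<Longrightarrow> x ** cl_bar x = mat 1"
  "det x = - 1 \<Longrightarrow> x ** (- cl_bar x) = mat 1"
  by (auto simp: det_2 cl_bar_eq cl_simps algebra_simps)

lemma unitary_iff_cl_N': "x ** conj_transpose x = mat 1 \<longleftrightarrow> cl_N' x = mat 1"
  by (simp add: cl_N'_def cl_t_eq matrix_left_right_inverse)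

lemma det_even: "x \<in> Cl_even \<Longrightarrow> det x = of_real (qnorm x)"
  and det_odd: "x \<in> Cl_odd \<Longrightarrow> det x = - of_real (qnorm x)"
  by (auto simp: Cl_even_iff Cl_odd_iff det_2 qnorm_def complex_eq_iff power2_eq_square)

lemma scaleR_mat1_eq_iff: "r *\<^sub>R mat 1 = (mat 1 :: cl) \<longleftrightarrow> r = 1"
  by (auto simp: cl_simps)

text \<open>If \<open>det x = 1\<close>, then \<open>conj_transpose x\<close> and
  \<open>cl_bar x\<close> are both right inverses of \<open>x\<close>, so they agree and
  \<open>x\<close> is even. Conversely, \<open>cl_N'\<close> and \<open>det\<close> both reduce to
  \<open>qnorm x\<close> on even elements.\<close>

lemma even_unitary_iff:
  "x \<in> Cl_even \<and> qnorm x = 1 \<longleftrightarrow> x ** conj_transpose x = mat 1 \<and> det x = 1"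
  by (metis Cl_even_iff_conj_transpose cl_N'_even det_even matrix_right_inverse_unique
      mult_cl_bar(1) of_real_1 scaleR_one unitary_iff_cl_N' scaleR_mat1_eq_iff)

lemma odd_unitary_iff:
  "x \<in> Cl_odd \<and> qnorm x = 1 \<longleftrightarrow> x ** conj_transpose x = mat 1 \<and> det x = - 1"
  by (metis Cl_odd_iff_conj_transpose cl_N'_odd det_odd matrix_right_inverse_unique
      mult_cl_bar(2) of_real_1 scaleR_one unitary_iff_cl_N' scaleR_mat1_eq_iff)

lemma invertible_if_unitary: "x ** conj_transpose x = mat 1 \<Longrightarrow> invertible x"
  by (auto simp: invertible_right_inverse)

lemma SU2_eq: "SU2 = {x \<in> Cl_even. qnorm x = 1}"
  by (auto simp: SU2_def GL2_def even_unitary_iff intro: invertible_if_unitary)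

lemma U2pm_eq: "U2pm = {x \<in> Cl_even \<union> Cl_odd. qnorm x = 1}"
  using even_unitary_iff odd_unitary_iff
  by (auto simp: U2pm_def GL2_def intro: invertible_if_unitary)

text \<open>Discharges the invertibility condition in the kernels.\<close>

lemma invertible_if_qnorm_1: "x \<in> Cl_even \<union> Cl_odd \<Longrightarrow> qnorm x = 1 \<Longrightarrow> invertible x"
  using even_unitary_iff odd_unitary_iff invertible_if_unitary by blast

lemma in_kernel_Cl_hom_iff:
  "x \<in> kernel Cl_hom real_scalars h \<longleftrightarrow> x \<in> Cl_even \<union> Cl_odd \<and> invertible x \<and> h x = mat 1"
  by (auto simp: kernel_def Cl_hom_def real_scalars_def GL2_def)

lemma Pin3_eq: "Pin3 = {x \<in> Cl_even. qnorm x = 1}"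
proof -
  \<comment> \<open>\<open>cl_N\<close> is \<open>- qnorm x\<close> times the unit on odd elements,
    so none of them lies in its kernel.\<close>
  have "- qnorm x \<noteq> 1" for x
    using qnorm_nonneg[of x] by linarith
  then have "cl_N x \<noteq> mat 1" if "x \<in> Cl_odd" for x
    using that by (metis cl_N_odd scaleR_mat1_eq_iff)
  moreover have "cl_N x = mat 1 \<longleftrightarrow> qnorm x = 1" if "x \<in> Cl_even" for x
    using that by (simp add: cl_N_even scaleR_mat1_eq_iff)
  ultimately show ?thesis
    using invertible_if_qnorm_1 by (auto simp: Pin3_def in_kernel_Cl_hom_iff)
qed

lemma Pin3'_eq: "Pin3' = {x \<in> Cl_even \<union> Cl_odd. qnorm x = 1}"
  using invertible_if_qnorm_1
  by (auto simp: Pin3'_def in_kernel_Cl_hom_iff cl_N'_even cl_N'_odd scaleR_mat1_eq_iff)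

lemma PIN3_eq: "PIN3 = {x \<in> Cl_even \<union> Cl_odd. qnorm x = 1}"
proof -
  have "cl_N x ** cl_N x = mat 1 \<longleftrightarrow> qnorm x = 1" if "x \<in> Cl_even \<union> Cl_odd" for x
  proof -
    \<comment> \<open>Squaring removes the sign that separates \<open>cl_N\<close> from
      \<open>cl_N'\<close>; nonnegativity then rules out \<open>qnorm x = - 1\<close>.\<close>
    have "cl_N x ** cl_N x = (qnorm x)\<^sup>2 *\<^sub>R mat 1"
      using that by (auto simp: cl_N'_sq cl_N'_even cl_N'_odd scaleR_mult_left power2_eq_square)
    then show ?thesis
      using qnorm_nonneg[of x] by (auto simp: scaleR_mat1_eq_iff power2_eq_1_iff)
  qed
  then show ?thesis
    using invertible_if_qnorm_1 by (auto simp: PIN3_def in_kernel_Cl_hom_iff)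
qed

theorem theorem6p5:
  "(SU2 = Spin3 \<and> Spin3 = Pin3) \<and> (U2pm = PIN3 \<and> PIN3 = Pin3')"
  \<comment> \<open>\<open>Pin3\<close> is already even, so intersecting with \<open>Cl_even\<close>
    leaves it unchanged.\<close>
  by (auto simp: SU2_eq Spin3_def Pin3_eq U2pm_eq PIN3_eq Pin3'_eq)

end
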